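(* Let $G=(V,E)$ be a connected claw-free graph with clique number $\omega(G)=3$. Then one of the following is true: (i) $G$ is the icosahedron; (ii) $G$ is the line graph $L(F)$ of a $3$-regular graph $F$; or (iii) there exists $v\in V$ with $\deg_{G^2}(v)\le 9$ such that $\deg_{G^2}(x)\le 11$ for all $x\in N_G(v)$; furthermore, either there exists $x^*\in N_G(v)$ with $\deg_{G^2}(x^* )\le 10$, or $N_G(v)$ induces a clique in $(G\setminus v)^2$.
   Context: A graph is claw-free if it has no induced $K_{1,3}$. The square $H^2$ of a graph $H$ is the graph on $V(H)$ in which two distinct vertices are adjacent iff they are at distance at most $2$ in $H$. $\deg_{G^2}(v)$ is the degree of $v$ in $G^2$; $N_G(v)$ is the open neighbourhood of $v$ in $G$; $G\setminus v$ is $G$ with $v$ deleted. *)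

theory Defs
  imports "Graph_Theory.Graph_Theory"
begin

text \<open>
  A finite simple graph is a \<^locale>\<open>pair_graph\<close>: a finite, loopfree, symmetric relation on the
  vertices. Since every edge is present as a pair of opposite arcs, the degree of a vertex is its
  \<^const>\<open>out_degree\<close>.
\<close>

definition claw_free :: "('a,'b) pre_digraph \<Rightarrow> bool" where
  "claw_free G \<longleftrightarrow> \<not> (\<exists>H. induced_subgraph H G \<and> K\<^bsub>1,3\<^esub> H)"

definition induces_clique :: "('a,'b) pre_digraph \<Rightarrow> 'a set \<Rightarrow> bool" where
  "induces_clique G C \<longleftrightarrow> C \<subseteq> verts G \<and> K\<^bsub>card C\<^esub> (G \<restriction> C)"

definition clique_number :: "('a,'b) pre_digraph \<Rightarrow> nat" where
  "clique_number G = Max {card C | C. induces_clique G C}"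

definition open_nbhd :: "('a,'b) pre_digraph \<Rightarrow> 'a \<Rightarrow> 'a set" where
  "open_nbhd G v = {u. v \<rightarrow>\<^bsub>G\<^esub> u}"

definition regular_graph :: "nat \<Rightarrow> ('a,'b) pre_digraph \<Rightarrow> bool" where
  "regular_graph k G \<longleftrightarrow> (\<forall>v \<in> verts G. out_degree G v = k)"

text \<open>The usual graph distance, i.e. the shortest-path distance for unit arc costs
  (infinite between different components).\<close>

definition graph_dist :: "('a,'b) pre_digraph \<Rightarrow> 'a \<Rightarrow> 'a \<Rightarrow> ereal" where
  "graph_dist G u v = wf_digraph.\<mu> G (\<lambda>_. 1) u v"

definition graph_square :: "('a,'b) pre_digraph \<Rightarrow> 'a pair_pre_digraph" where
  "graph_square G = \<lparr> pverts = verts G,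
     parcs = {(u, v). u \<in> verts G \<and> v \<in> verts G \<and> u \<noteq> v \<and> graph_dist G u v \<le> 2} \<rparr>"

definition edge_set :: "('a,'b) pre_digraph \<Rightarrow> 'a set set" where
  "edge_set G = {{u, v} | u v. u \<rightarrow>\<^bsub>G\<^esub> v}"

definition line_graph :: "('a,'b) pre_digraph \<Rightarrow> 'a set pair_pre_digraph" where
  "line_graph G = \<lparr> pverts = edge_set G,
     parcs = {(e, f). e \<in> edge_set G \<and> f \<in> edge_set G \<and> e \<noteq> f \<and> e \<inter> f \<noteq> {}} \<rparr>"

text \<open>
  The icosahedron as a capped pentagonal antiprism: poles \<open>0\<close> and \<open>11\<close>, upper pentagon
  \<open>1, \<dots>, 5\<close>, lower pentagon \<open>6, \<dots>, 10\<close>.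
\<close>

definition icosahedron :: "nat pair_pre_digraph" where
  "icosahedron =
    (let A = (\<Union>i<5. let j = (i + 1) mod 5 in
           {(0, 1 + i), (1 + i, 1 + j), (1 + i, 6 + i), (1 + i, 6 + j), (6 + i, 6 + j), (6 + i, 11)})
     in \<lparr> pverts = {..<12}, parcs = A \<union> A\<inverse> \<rparr>)"

end

theory Submission
  imports Defs
begin

text \<open>
  Since \<open>G\<close> has neither a claw nor a \<open>K\<^sub>4\<close>, an edge has at most two common neighbours, and the
  neighbours of \<open>x \<in> N(v)\<close> outside \<open>N(v) \<union> {v}\<close> form a clique, so there are at most two of them.
  Counting second neighbours with these bounds gives \<open>deg\<^bsub>G\<^sup>2\<^esub>(v) \<le> 9\<close> unless \<open>N(v)\<close> is a
  \<open>5\<close>-cycle, where the bound is \<open>10\<close>, or a perfect matching on four vertices (\<open>v\<close> is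
  matched), where a non-matched neighbour of degree other than \<open>5\<close> lowers the bound \<open>12\<close> to \<open>11\<close>.
  So any vertex of neither exceptional kind proves (iii); if all its neighbours are matched, then it
  has exactly two neighbours and they are adjacent. Otherwise every vertex is exceptional; the two
  kinds are never adjacent, so by connectedness only one of them occurs. Graphs that are locally
  \<open>C\<^sub>5\<close> are the icosahedron, and graphs that are locally \<open>2K\<^sub>2\<close> are line graphs of the cubic graph
  whose vertices are the triangles.
\<close>

section \<open>Degrees in the square\<close>

lemma card_le_2I:
  assumes "\<And>a b c. \<lbrakk>a \<in> S; b \<in> S; c \<in> S; a \<noteq> b; a \<noteq> c; b \<noteq> c\<rbrakk> \<Longrightarrow> False"
  shows "card S \<le> 2"
proof (rule ccontr)
  assume "\<not> card S \<le> 2"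
  then obtain T where "T \<subseteq> S" "card T = 3"
    by (metis not_less_eq_eq numeral_2_eq_2 numeral_3_eq_3 obtain_subset_with_card_n)
  then obtain a b c where "T = {a, b, c}" "a \<noteq> b" "a \<noteq> c" "b \<noteq> c"
    unfolding card_3_iff by blast
  with \<open>T \<subseteq> S\<close> show False using assms[of a b c] by simp
qed

lemma double_counting_le:
  assumes "finite A" "finite B" and "\<And>y. y \<in> B \<Longrightarrow> k \<le> card {x \<in> A. R x y}"
  shows "k * card B \<le> (\<Sum>x\<in>A. card {y \<in> B. R x y})"
proof -
  have "k * card B \<le> (\<Sum>y\<in>B. card {x \<in> A. R x y})"
    using sum_mono[of B "\<lambda>_. k" "\<lambda>y. card {x \<in> A. R x y}"] assms(3) by (simp add: mult.commute)
  also have "\<dots> = (\<Sum>y\<in>B. \<Sum>x | x \<in> A \<and> R x y. 1)" by simp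
  also have "\<dots> = (\<Sum>x\<in>A. \<Sum>y | y \<in> B \<and> R x y. 1)"
    using assms by (intro sum.swap_restrict) auto
  finally show ?thesis by simp
qed

text \<open>The graph is a bare neighbourhood function on the whole type. A point outside the graph
  can be given an empty neighbourhood, so the local lemmas need no membership hypotheses. By
  \<open>irrefl\<close>, the adjacencies in \<open>no_K4\<close> already force four distinct
  points.\<close>

locale claw_K4_free =
  fixes N :: "'a \<Rightarrow> 'a set"
  assumes fin [simp]: "finite (N v)"
    and sym: "u \<in> N v \<Longrightarrow> v \<in> N u"
    and irrefl [simp]: "v \<notin> N v"
    and no_claw: "\<lbrakk>a \<in> N v; b \<in> N v; c \<in> N v; a \<noteq> b; a \<noteq> c; b \<noteq> c\<rbrakk>
      \<Longrightarrow> b \<in> N a \<or> c \<in> N a \<or> c \<in> N b"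
    and no_K4: "\<lbrakk>a \<in> N v; b \<in> N v; c \<in> N v; b \<in> N a; c \<in> N a; c \<in> N b\<rbrakk> \<Longrightarrow> False"
begin

text \<open>For \<open>x\<close> in \<open>N v\<close>, these are the neighbours of \<open>x\<close>
  at distance exactly two from \<open>v\<close>.\<close>

definition outer :: "'a \<Rightarrow> 'a \<Rightarrow> 'a set" where
  "outer v x = N x - insert v (N v)"

definition sphere2 :: "'a \<Rightarrow> 'a set" where
  "sphere2 v = (\<Union>x\<in>N v. outer v x)"

text \<open>A 1-regular graph on four vertices is a pair of disjoint edges, so this says that
  \<open>N v\<close> induces 2K2.\<close>

definition matched :: "'a \<Rightarrow> bool" where
  "matched v \<longleftrightarrow> card (N v) = 4 \<and> (\<forall>x\<in>N v. card (N v \<inter> N x) = 1)"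

lemma sym_iff: "u \<in> N v \<longleftrightarrow> v \<in> N u"
  using sym by blast

lemma finite_outer [simp]: "finite (outer v x)"
  by (simp add: outer_def)

lemma finite_sphere2 [simp]: "finite (sphere2 v)"
  by (simp add: sphere2_def)

text \<open>Otherwise \<open>x\<close> would be the centre of a claw with leaves \<open>v\<close>,
  \<open>a\<close>, \<open>b\<close>.\<close>

lemma outer_clique:
  assumes "x \<in> N v" "a \<in> outer v x" "b \<in> outer v x" "a \<noteq> b"
  shows "b \<in> N a"
  using no_claw[of v x a b] assms by (auto simp: outer_def sym_iff)

text \<open>Three such points are pairwise adjacent by \<open>outer_clique\<close> and would form a
  K4 with \<open>x\<close>.\<close>

lemma card_outer_le: "x \<in> N v \<Longrightarrow> card (outer v x) \<le> 2"
  by (rule card_le_2I) (metis Diff_iff outer_clique no_K4 outer_def)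

text \<open>Among three common neighbours two are adjacent, since there is no claw at
  \<open>v\<close>; these two form a K4 with \<open>v\<close> and \<open>x\<close>.\<close>

lemma card_common_le: "x \<in> N v \<Longrightarrow> card (N v \<inter> N x) \<le> 2"
  by (rule card_le_2I) (metis Int_iff no_claw no_K4 sym)

lemma card_outer:
  assumes "x \<in> N v"
  shows "card (N x) = 1 + card (N v \<inter> N x) + card (outer v x)"
proof -
  have eq: "N x = insert v ((N v \<inter> N x) \<union> outer v x)"
    using assms sym by (auto simp: outer_def)
  have "card (insert v ((N v \<inter> N x) \<union> outer v x)) = Suc (card ((N v \<inter> N x) \<union> outer v x))"
    by (rule card_insert_disjoint) (auto simp: outer_def)
  also have "card ((N v \<inter> N x) \<union> outer v x) = card (N v \<inter> N x) + card (outer v x)"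
    by (rule card_Un_disjoint) (auto simp: outer_def)
  finally show ?thesis using eq by simp
qed

text \<open>This is \<open>card_outer\<close> with the roles of \<open>v\<close> and
  \<open>x\<close> exchanged: the 3 counts \<open>x\<close> and at most two points of
  \<open>outer x v\<close>.\<close>

lemma degree_le_common:
  assumes "x \<in> N v"
  shows "card (N v) \<le> 3 + card (N v \<inter> N x)"
  using card_outer[of v x] card_outer_le[of v x] assms sym[of x v] by (simp add: Int_commute)

lemma degree_le_5: "card (N v) \<le> 5"
proof (cases "N v = {}")
  case False
  then obtain x where "x \<in> N v" by blast
  then show ?thesis using degree_le_common[of x v] card_common_le[of x v] by linarith
qed simp

text \<open>The two common neighbours of \<open>v\<close> and \<open>x\<close> are nonadjacent, else
  there is a K4. Hence \<open>y\<close> must be adjacent to one of them, or all three would be the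
  leaves of a claw at \<open>x\<close>.\<close>

lemma outer_shared:
  assumes "x \<in> N v" "card (N v \<inter> N x) = 2" "y \<in> outer v x"
  shows "\<exists>p \<in> N v \<inter> N x. y \<in> outer v p"
proof -
  obtain p q where pq: "N v \<inter> N x = {p, q}" "p \<noteq> q"
    using assms(2) by (auto simp: card_2_iff)
  then have "p \<in> N v" "p \<in> N x" "q \<in> N v" "q \<in> N x" by blast+
  moreover from this have "q \<notin> N p" using no_K4[of x v p q] assms(1) by (meson sym)
  ultimately have "y \<in> N p \<or> y \<in> N q"
    using no_claw[of p x q y] assms pq by (auto simp: outer_def)
  then show ?thesis using pq assms(3) by (auto simp: outer_def)
qed

text \<open>Two shared points are adjacent by \<open>outer_clique\<close> and would form a K4 with
  \<open>x\<close> and \<open>q\<close>.\<close>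

lemma card_outer_Int_le:
  assumes "x \<in> N v" "q \<in> N v" "q \<in> N x"
  shows "card (outer v x \<inter> outer v q) \<le> 1"
proof (rule ccontr)
  assume "\<not> ?thesis"
  then obtain a b where "a \<in> outer v x \<inter> outer v q" "b \<in> outer v x \<inter> outer v q" "a \<noteq> b"
    by (metis One_nat_def card_le_Suc0_iff_eq finite_Int finite_outer)
  then show False
    using outer_clique[of x v a b] no_K4[of q x a b] assms by (auto simp: outer_def)
qed

lemma card_UN_outer_le:
  assumes "S \<subseteq> N v"
  shows "card (\<Union>x\<in>S. outer v x) \<le> 2 * card S"
proof -
  have "finite S" using assms finite_subset fin by blast
  then have "card (\<Union>x\<in>S. outer v x) \<le> (\<Sum>x\<in>S. card (outer v x))"
    by (rule card_UN_le)
  also have "\<dots> \<le> (\<Sum>x\<in>S. 2)"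
    using assms card_outer_le by (intro sum_mono) blast
  finally show ?thesis by simp
qed

section \<open>Second neighbours of vertices of degree five and four\<close>

lemma common_eq_2_if_degree_5:
  assumes "card (N v) = 5" "x \<in> N v"
  shows "card (N v \<inter> N x) = 2"
  using degree_le_common[of x v] card_common_le[of x v] assms by linarith

text \<open>Double counting of pairs: by \<open>outer_shared\<close> each second neighbour is
  reached through at least two neighbours, and each of the five neighbours reaches at most two, so
  twice the size is at most 10.\<close>

lemma card_sphere2_degree_5:
  assumes "card (N v) = 5"
  shows "card (sphere2 v) \<le> 5"
proof -
  have "2 * card (sphere2 v) \<le> (\<Sum>x\<in>N v. card {y \<in> sphere2 v. y \<in> outer v x})"
  proof (rule double_counting_le)
    fix y assume "y \<in> sphere2 v"
    then obtain x where x: "x \<in> N v" "y \<in> outer v x" by (auto simp: sphere2_def)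
    then obtain p where "p \<in> N v \<inter> N x" "y \<in> outer v p"
      using outer_shared common_eq_2_if_degree_5[OF assms] by blast
    with x have "{x, p} \<subseteq> {x \<in> N v. y \<in> outer v x}" "x \<noteq> p" by auto
    then show "2 \<le> card {x \<in> N v. y \<in> outer v x}"
      by (metis card_2_iff card_mono fin finite_Collect_conjI Collect_mem_eq)
  qed auto
  also have "\<dots> \<le> (\<Sum>x\<in>N v. 2)"
  proof (rule sum_mono)
    fix x assume x: "x \<in> N v"
    then have "{y \<in> sphere2 v. y \<in> outer v x} = outer v x" by (auto simp: sphere2_def)
    then show "card {y \<in> sphere2 v. y \<in> outer v x} \<le> 2" using card_outer_le x by simp
  qed
  finally show ?thesis using assms by simp
qed

text \<open>The neighbourhood contains a spanning path \<open>p\<close>, \<open>x\<close>,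
  \<open>q\<close>, \<open>r\<close>; whether its ends are adjacent is left open. In degree 4 every
  neighbour has one or two neighbours inside \<open>N v\<close>. Some \<open>x\<close> has two, and
  the fourth vertex \<open>r\<close>, not being adjacent to \<open>x\<close>, must be attached to
  \<open>p\<close> or \<open>q\<close>.\<close>

lemma degree_4_path:
  assumes "card (N v) = 4" "\<not> matched v"
  obtains p x q r where "N v = {p, x, q, r}" "distinct [p, x, q, r]"
    "N v \<inter> N x = {p, q}" "N v \<inter> N q = {x, r}"
proof -
  have ge1: "card (N v \<inter> N y) \<ge> 1" if "y \<in> N v" for y
    using degree_le_common[OF that] assms(1) by simp
  obtain x where x: "x \<in> N v" "card (N v \<inter> N x) \<noteq> 1"
    using assms by (auto simp: matched_def)
  then have "card (N v \<inter> N x) = 2" using ge1[of x] card_common_le[of x v] by simp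
  then obtain p q where pq: "N v \<inter> N x = {p, q}" "p \<noteq> q" by (auto simp: card_2_iff)
  then have sub: "{x, p, q} \<subseteq> N v" and xpq: "x \<noteq> p" "x \<noteq> q" using x by auto
  then have "card (N v - {x, p, q}) = 1" using assms(1) pq(2) by (simp add: card_Diff_subset)
  then obtain r where "N v - {x, p, q} = {r}" by (auto simp: card_1_singleton_iff)
  then have r: "N v = {x, p, q, r}" "r \<noteq> x" "r \<noteq> p" "r \<noteq> q" using sub by auto
  have rx: "x \<notin> N r" using pq r sym[of x r] by auto
  have "N v \<inter> N r \<noteq> {}" using ge1[of r] r by force
  then have "p \<in> N r \<or> q \<in> N r" using r rx by auto
  then show thesis
  proof
    assume "p \<in> N r"
    then have "{x, r} \<subseteq> N v \<inter> N p" using sym r pq by auto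
    moreover have "card {x, r} = 2" using r by simp
    ultimately have "N v \<inter> N p = {x, r}"
      using card_common_le[of p v] r by (metis card_seteq fin finite_Int insertCI)
    moreover have "N v = {q, x, p, r}" "N v \<inter> N x = {q, p}" using r pq by auto
    ultimately show thesis using that[of q x p r] r pq(2) xpq by simp
  next
    assume "q \<in> N r"
    then have "{x, r} \<subseteq> N v \<inter> N q" using sym r pq by auto
    moreover have "card {x, r} = 2" using r by simp
    ultimately have "N v \<inter> N q = {x, r}"
      using card_common_le[of q v] r by (metis card_seteq fin finite_Int insertCI)
    moreover have "N v = {p, x, q, r}" using r by auto
    ultimately show thesis using that[of p x q r] r pq xpq by simp
  qed
qed

text \<open>A second neighbour not reached through an end of the path is reached, by
  \<open>outer_shared\<close>, through both inner vertices, and these share at most one. The total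
  is 2 + 2 + 1.\<close>

lemma card_sphere2_degree_4:
  assumes "card (N v) = 4" "\<not> matched v"
  shows "card (sphere2 v) \<le> 5"
proof -
  obtain p x q r where N: "N v = {p, x, q, r}" "distinct [p, x, q, r]"
    and c: "N v \<inter> N x = {p, q}" "N v \<inter> N q = {x, r}"
    using degree_4_path[OF assms] .
  have "outer v x \<subseteq> outer v p \<union> outer v q" "outer v q \<subseteq> outer v x \<union> outer v r"
    using outer_shared[of x v] outer_shared[of q v] N c by auto
  then have "sphere2 v \<subseteq> outer v p \<union> outer v r \<union> (outer v x \<inter> outer v q)"
    unfolding sphere2_def N(1) by auto
  then have "card (sphere2 v) \<le> card (outer v p \<union> outer v r \<union> (outer v x \<inter> outer v q))"
    by (intro card_mono) auto
  also have "\<dots> \<le> card (outer v p) + card (outer v r) + card (outer v x \<inter> outer v q)"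
    by (meson add_right_mono card_Un_le le_trans)
  also have "\<dots> \<le> 2 + 2 + 1"
    using N c by (intro add_mono card_outer_le card_outer_Int_le) auto
  finally show ?thesis by simp
qed

section \<open>Degree bounds in the square\<close>

lemma card_sphere2_le: "card (sphere2 v) \<le> 2 * card (N v)"
  using card_UN_outer_le[of "N v" v] by (simp add: sphere2_def)

lemma degree_square_le_9:
  assumes "\<not> matched v" "card (N v) \<noteq> 5"
  shows "card (N v) + card (sphere2 v) \<le> 9"
proof (cases "card (N v) = 4")
  case True
  then show ?thesis using card_sphere2_degree_4 assms by simp
next
  case False
  then show ?thesis using card_sphere2_le[of v] degree_le_5[of v] assms by simp
qed

lemma degree_square_le_10:
  assumes "\<not> matched v"
  shows "card (N v) + card (sphere2 v) \<le> 10"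
  using degree_square_le_9[OF assms] card_sphere2_degree_5[of v] by fastforce

text \<open>Only a matched \<open>x\<close> needs work, where the general bound is 4 + 8. The
  ordinary neighbour \<open>v\<close> saves one second neighbour of \<open>x\<close>: either
  \<open>outer x v\<close> is small, or it overlaps another outer set.\<close>

lemma degree_square_le_11:
  assumes v: "\<not> matched v" "card (N v) \<noteq> 5" and x: "x \<in> N v"
  shows "card (N x) + card (sphere2 x) \<le> 11"
proof (cases "matched x")
  case False
  then show ?thesis using degree_square_le_10[of x] by simp
next
  case True
  then have d: "card (N x) = 4" by (simp add: matched_def)
  have vx: "v \<in> N x" using x sym by blast
  have c: "card (N x \<inter> N v) = 1" using True vx by (simp add: matched_def)
  have "card (sphere2 x) \<le> 7"
  proof (cases "card (N v) = 4")
    case False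
    \<comment> \<open>Here \<open>v\<close> has degree at most 3; removing \<open>x\<close> and the
      single common neighbour leaves at most one vertex.\<close>
    then have "card (outer x v) \<le> 1"
      using card_outer[OF vx] c degree_le_5[of v] v by simp
    moreover have "sphere2 x = outer x v \<union> (\<Union>y\<in>N x - {v}. outer x y)"
      using vx by (auto simp: sphere2_def)
    moreover have "card (\<Union>y\<in>N x - {v}. outer x y) \<le> 6"
      using card_UN_outer_le[of "N x - {v}" x] d vx by simp
    ultimately show ?thesis
      using card_Un_le[of "outer x v" "\<Union>y\<in>N x - {v}. outer x y"] by simp
  next
    case True
    obtain p z q r where N: "N v = {p, z, q, r}" "distinct [p, z, q, r]"
      and cz: "N v \<inter> N z = {p, q}" "N v \<inter> N q = {z, r}"
      using degree_4_path[OF True v(1)] .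
    \<comment> \<open>Having only one neighbour in \<open>N v\<close>, \<open>x\<close> is an end of
      the path. Take for \<open>w\<close> the next vertex on the path and for \<open>y\<close> the
      one after it: \<open>y\<close> is adjacent to both \<open>v\<close> and \<open>w\<close> but
      not to \<open>x\<close>.\<close>
    have "\<exists>w y. w \<in> N x \<inter> N v \<and> y \<in> outer x v \<inter> outer x w"
    proof -
      have "x \<noteq> z" "x \<noteq> q" using cz c N(2) by (auto simp: Int_commute card_1_singleton_iff)
      then consider "x = p" | "x = r" using x N by auto
      then show ?thesis
      proof cases
        case 1
        have "q \<notin> N p" using cz N(2) sym[of q p] N(1) by auto
        then show ?thesis using 1 N cz sym[of _ z]
          by (intro exI[of _ z] exI[of _ q]) (auto simp: outer_def)
      next
        case 2
        have "z \<notin> N r" using cz N(2) sym[of z r] N(1) by auto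
        then show ?thesis using 2 N cz sym[of _ q]
          by (intro exI[of _ q] exI[of _ z]) (auto simp: outer_def)
      qed
    qed
    then obtain w y where w: "w \<in> N x" "w \<in> N v" and y: "y \<in> outer x v \<inter> outer x w" by blast
    have wv: "w \<noteq> v" using w by auto
    have "1 \<le> card (outer x v \<inter> outer x w)"
      using y by (metis One_nat_def Suc_leI card_gt_0_iff empty_iff finite_Int finite_outer)
    then have "card (outer x v \<union> outer x w) \<le> 3"
      using card_Un_Int[of "outer x v" "outer x w"] card_outer_le[OF vx] card_outer_le[OF w(1)]
      by simp
    moreover have "sphere2 x = (outer x v \<union> outer x w) \<union> (\<Union>y\<in>N x - {v, w}. outer x y)"
      using vx w by (auto simp: sphere2_def)
    moreover have "card (N x - {v, w}) = 2" using d vx w wv by (simp add: card_Diff_subset)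
    then have "card (\<Union>y\<in>N x - {v, w}. outer x y) \<le> 4"
      using card_UN_outer_le[of "N x - {v, w}" x] by simp
    ultimately show ?thesis
      using card_Un_le[of "outer x v \<union> outer x w" "\<Union>y\<in>N x - {v, w}. outer x y"] by simp
  qed
  then show ?thesis using d by simp
qed

text \<open>Matchedness of the neighbours makes \<open>N v\<close> induce a 1-regular graph. With a
  second edge it would have at least four vertices, hence exactly four by
  \<open>degree_le_common\<close>, and \<open>v\<close> would be matched.\<close>

lemma all_neighbours_matched:
  assumes "\<not> matched v" "N v \<noteq> {}" and all: "\<And>x. x \<in> N v \<Longrightarrow> matched x"
  obtains a b where "N v = {a, b}" "b \<in> N a"
proof -
  have one: "card (N v \<inter> N x) = 1" if "x \<in> N v" for x
    using all[OF that] sym[OF that] by (simp add: matched_def Int_commute)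
  have uniq: "y = z" if "x \<in> N v" "y \<in> N v" "z \<in> N v" "y \<in> N x" "z \<in> N x" for x y z
    using one[OF that(1)] that by (metis IntI card_1_singletonE singletonD)
  have ex: "\<exists>y. y \<in> N v \<and> y \<in> N x" if "x \<in> N v" for x
    using one[OF that] by (auto simp: card_1_singleton_iff)
  obtain a b where ab: "a \<in> N v" "b \<in> N v" "b \<in> N a" using assms(2) ex by blast
  have "N v = {a, b}"
  proof (rule ccontr)
    assume "N v \<noteq> {a, b}"
    then obtain c where c: "c \<in> N v" "c \<noteq> a" "c \<noteq> b" using ab by blast
    obtain e where e: "e \<in> N v" "e \<in> N c" using ex c by blast
    have "e \<noteq> a" "e \<noteq> b" "e \<noteq> c" using uniq[of a b c] uniq[of b a c] ab c e sym by auto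
    moreover have "a \<noteq> b" using ab by auto
    ultimately have "card {a, b, c, e} = 4" using c by auto
    moreover have "{a, b, c, e} \<subseteq> N v" using ab c e by simp
    ultimately have "4 \<le> card (N v)" by (metis card_mono fin)
    moreover have "card (N v) \<le> 4" using degree_le_common[OF c(1)] one[OF c(1)] by simp
    ultimately show False using assms(1) one by (simp add: matched_def)
  qed
  then show thesis using that ab by blast
qed

text \<open>The edge has just one common neighbour, so \<open>degree_le_common\<close> bounds the
  degree by 4.\<close>

lemma matched_adjacent_degree_5:
  assumes "x \<in> N v" "matched x"
  shows "card (N v) \<noteq> 5"
  using degree_le_common[OF assms(1)] assms sym[OF assms(1)]
  by (auto simp: matched_def Int_commute)

end

section \<open>Locally pentagonal graphs\<close>

locale locally_pentagonal = claw_K4_free +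
  fixes V :: "'a set"
  assumes degree_5: "v \<in> V \<Longrightarrow> card (N v) = 5"
    and N_subset: "N v \<subseteq> V"
begin

lemma in_V: "x \<in> N v \<Longrightarrow> x \<in> V"
  using N_subset by blast

lemma common_2: "x \<in> N v \<Longrightarrow> card (N v \<inter> N x) = 2"
  by (metis common_eq_2_if_degree_5 degree_5 in_V sym)

lemma common_not_3:
  assumes "x \<in> N v" "{a, b, c} \<subseteq> N v \<inter> N x" "a \<noteq> b" "a \<noteq> c" "b \<noteq> c"
  shows False
proof -
  have "card {a, b, c} \<le> card (N v \<inter> N x)"
    using assms(2) by (intro card_mono) auto
  then show False using common_2[OF assms(1)] assms by simp
qed

lemma common_other:
  assumes "x \<in> N v" "a \<in> N v" "a \<in> N x"
  shows "\<exists>b. N v \<inter> N x = {a, b} \<and> b \<noteq> a"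
proof -
  obtain p q where "N v \<inter> N x = {p, q}" "p \<noteq> q"
    using common_2[OF assms(1)] by (auto simp: card_2_iff)
  moreover from this have "a = p \<or> a = q" using assms by blast
  ultimately show ?thesis by blast
qed

lemma N_eqI:
  assumes "v \<in> V" "set xs \<subseteq> N v" "distinct xs" "length xs = 5"
  shows "N v = set xs"
  using assms degree_5[of v] by (metis card_subset_eq distinct_card fin)

text \<open>The fifth vertex of \<open>N v\<close> has a neighbour on the cycle, and that neighbour
  would then have three common neighbours with \<open>v\<close>.\<close>

lemma no_4_cycle_in_nbhd:
  assumes "{a, b, c, d} \<subseteq> N v" "b \<in> N a" "c \<in> N b" "d \<in> N c" "a \<in> N d" "a \<noteq> c" "b \<noteq> d"
  shows False
proof -
  have ne: "a \<noteq> b" "b \<noteq> c" "c \<noteq> d" "d \<noteq> a" using assms irrefl by blast+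
  have V: "v \<in> V" using assms(1) in_V sym by blast
  have "card {a, b, c, d} = 4" using ne assms by simp
  then have "{a, b, c, d} \<noteq> N v" using degree_5[OF V] by auto
  then obtain e where e: "e \<in> N v" "e \<notin> {a, b, c, d}" using assms(1) by blast
  then have N: "N v = set [a, b, c, d, e]"
    using assms ne V by (intro N_eqI) auto
  have adj_rev: "a \<in> N b" "b \<in> N c" "c \<in> N d" "d \<in> N a" using assms sym by blast+
  have "N v \<inter> N e \<noteq> {}" using common_2[OF e(1)] by force
  then consider "a \<in> N e" | "b \<in> N e" | "c \<in> N e" | "d \<in> N e" using N by auto
  then show False
  proof cases
    case 1
    show False using 1 common_not_3[of a v b d e] e assms adj_rev sym[OF 1] by auto
  next
    case 2
    show False using 2 common_not_3[of b v a c e] e assms adj_rev sym[OF 2] by auto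
  next
    case 3
    show False using 3 common_not_3[of c v b d e] e assms adj_rev sym[OF 3] by auto
  next
    case 4
    show False using 4 common_not_3[of d v a c e] e assms adj_rev sym[OF 4] by auto
  qed
qed

text \<open>\<open>N v\<close> induces a 2-regular graph on five vertices, so it is a 5-cycle. It is
  delivered as a sequence of period 5, which lets later arguments be stated once for a general
  index.\<close>

lemma nbhd_5_cycle:
  assumes "v \<in> V"
  obtains x :: "nat \<Rightarrow> 'a" where "\<And>i. x (i + 5) = x i" "\<And>i. x i \<in> N v"
    "\<And>i. x (i + 1) \<in> N (x i)" "\<And>i. x (i + 2) \<noteq> x i"
proof -
  have "\<exists>a b c d e. {a, b, c, d, e} \<subseteq> N v \<and> distinct [a, b, c, d, e] \<and>
    b \<in> N a \<and> c \<in> N b \<and> d \<in> N c \<and> e \<in> N d \<and> a \<in> N e"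
  proof -
    obtain a where a: "a \<in> N v" using degree_5[OF assms] by fastforce
    obtain b e where be: "N v \<inter> N a = {b, e}" "b \<noteq> e"
      using common_2[OF a] by (auto simp: card_2_iff)
    then have sub: "{a, b, e} \<subseteq> N v" and ne: "a \<noteq> b" "a \<noteq> e" using a by auto
    then have "card (N v - {a, b, e}) = 2"
      using be(2) degree_5[OF assms] by (simp add: card_Diff_subset)
    then obtain c d where "N v - {a, b, e} = {c, d}" "c \<noteq> d" by (auto simp: card_2_iff)
    then have N: "N v = {a, b, e, c, d}" and ne': "c \<noteq> d" "c \<notin> {a, b, e}" "d \<notin> {a, b, e}"
      using sub by auto
    have acd: "c \<notin> N a" "d \<notin> N a" using be N ne' by auto
    \<comment> \<open>Otherwise \<open>a\<close>, \<open>c\<close>, \<open>d\<close> are the leaves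
      of a claw at \<open>v\<close>.\<close>
    then have cd: "d \<in> N c" using no_claw[of a v c d] N ne' by auto
    have eb: "e \<notin> N b" using no_K4[of a v b e] be N by auto
    have adj: "b \<in> N a" "e \<in> N a" using be by auto
    have adj': "a \<in> N b" "a \<in> N e" using adj[THEN sym] .
    obtain b' where b': "N v \<inter> N b = {a, b'}" "b' \<noteq> a"
      using common_other[of b v a] a adj' sub by auto
    obtain e' where e': "N v \<inter> N e = {a, e'}" "e' \<noteq> a"
      using common_other[of e v a] a adj' sub by auto
    have in': "b' \<in> N v" "b' \<in> N b" "e' \<in> N v" "e' \<in> N e" using b' e' by auto
    have "b \<notin> N e" using eb sym by blast
    then have "b' \<noteq> e" "e' \<noteq> b" "b' \<noteq> b" "e' \<noteq> e" using in' eb by auto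
    then have "b' \<in> {c, d}" "e' \<in> {c, d}" using in' b'(2) e'(2) N by auto
    \<comment> \<open>If both walks from \<open>a\<close> met at the same vertex, they would close a
      4-cycle in \<open>N v\<close>.\<close>
    moreover have "b' \<noteq> e'"
    proof
      assume "b' = e'"
      then have "e \<in> N b'" using in' sym by simp
      then show False
        using no_4_cycle_in_nbhd[of a b b' e v] adj adj' in' b'(2) be(2) sub by simp
    qed
    ultimately have cases: "b' = c \<and> e' = d \<or> b' = d \<and> e' = c" by blast
    have "e \<in> N e'" using sym[OF in'(4)] .
    moreover have "e' \<in> N b'" using cases cd sym[OF cd] by auto
    moreover have "distinct [a, b, b', e', e]" "{a, b, b', e', e} \<subseteq> N v"
      using cases ne ne' be(2) N by auto
    ultimately show ?thesis using adj adj' in' by blast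
  qed
  then obtain a b c d e where *: "{a, b, c, d, e} \<subseteq> N v" "distinct [a, b, c, d, e]"
    "b \<in> N a" "c \<in> N b" "d \<in> N c" "e \<in> N d" "a \<in> N e" by blast
  define x where "x i = [a, b, c, d, e] ! (i mod 5)" for i :: nat
  have "x i \<in> N v \<and> x (i + 1) \<in> N (x i) \<and> x (i + 2) \<noteq> x i" for i
  proof -
    have s: "(i + 1) mod 5 = (i mod 5 + 1) mod 5" "(i + 2) mod 5 = (i mod 5 + 2) mod 5"
      by (simp_all only: mod_add_left_eq)
    have "i mod 5 < 5" by simp
    then consider "i mod 5 = 0" | "i mod 5 = 1" | "i mod 5 = 2" | "i mod 5 = 3" | "i mod 5 = 4"
      by linarith
    then show ?thesis
      unfolding x_def s using * by cases auto
  qed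
  moreover have "x (i + 5) = x i" for i by (simp add: x_def)
  ultimately show thesis using that by blast
qed

end

section \<open>Building the icosahedron around a pentagonal neighbourhood\<close>

locale pentagonal_link = locally_pentagonal +
  fixes v :: 'a and x :: "nat \<Rightarrow> 'a"
  assumes v: "v \<in> V"
    and x_period: "x (i + 5) = x i"
    and x_in: "x i \<in> N v"
    and x_adj: "x (i + 1) \<in> N (x i)"
    and x_ne2: "x (i + 2) \<noteq> x i"
begin

text \<open>The \<open>y i\<close> form the lower pentagon of the icosahedron with pole \<open>v\<close> and upper pentagon \<open>x i\<close>.\<close>

definition y :: "nat \<Rightarrow> 'a" where
  "y i = (THE w. w \<in> N (x i) \<and> w \<in> N (x (i + 1)) \<and> w \<noteq> v)"

text \<open>Indices are naturals, so \<open>i + 4\<close> and \<open>i + 3\<close> stand for the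
  cyclic \<open>i - 1\<close> and \<open>i - 2\<close>. These rewrites expose \<open>i + 5\<close>,
  so that periodicity transfers facts about steps 1 and 2 to steps 4 and 3.\<close>

lemma shift5: "i + 1 + 4 = i + (5::nat)" "i + 2 + 3 = i + (5::nat)" "i + 3 + 2 = i + (5::nat)"
  "i + 4 + 1 = i + (5::nat)" by simp_all

lemma y_period: "y (i + 5) = y i"
  using x_period[of i] x_period[of "i + 1"] by (simp add: y_def add.commute add.left_commute)

lemma v_in: "v \<in> N (x i)"
  using x_in sym by blast

lemma x_ne: "x (i + 1) \<noteq> x i" "x (i + 2) \<noteq> x i" "x (i + 3) \<noteq> x i" "x (i + 4) \<noteq> x i"
proof -
  show "x (i + 1) \<noteq> x i" for i using x_adj[of i] by force
  from this[of "i + 4"] show "x (i + 4) \<noteq> x i" by (simp only: shift5 x_period) simp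
  show "x (i + 2) \<noteq> x i" for i by (rule x_ne2)
  from this[of "i + 3"] show "x (i + 3) \<noteq> x i" by (simp only: shift5 x_period) simp
qed

lemma x_adj': "x (i + 4) \<in> N (x i)"
  using x_adj[of "i + 4"] sym by (simp only: shift5 x_period)

lemma y_ex1: "\<exists>!w. w \<in> N (x i) \<and> w \<in> N (x (i + 1)) \<and> w \<noteq> v"
  using common_other[OF x_adj v_in v_in, of i] by auto

lemma y_props: "y i \<in> N (x i)" "y i \<in> N (x (i + 1))" "y i \<noteq> v"
  using theI'[OF y_ex1[of i]] by (simp_all add: y_def)

lemma y_uniq: "\<lbrakk>w \<in> N (x i); w \<in> N (x (i + 1)); w \<noteq> v\<rbrakk> \<Longrightarrow> w = y i"
  using y_ex1[of i] y_props[of i] by blast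

lemma y_notin: "y i \<notin> N v"
  using no_K4[of "x i" v "x (i + 1)" "y i"] x_in x_adj y_props by blast

lemma y_ne_x [simp]: "y i \<noteq> x j" "x j \<noteq> y i"
  using y_notin x_in by metis+

lemma v_ne [simp]: "x i \<noteq> v" "v \<noteq> x i" "y i \<noteq> v" "v \<noteq> y i"
  using x_in y_props(3) irrefl by metis+

text \<open>If the two agreed, \<open>v\<close>, \<open>x i\<close>, \<open>y i\<close>,
  \<open>x (i + 2)\<close> would be a 4-cycle in the neighbourhood of
  \<open>x (i + 1)\<close>.\<close>

lemma y_ne_Suc: "y (i + 1) \<noteq> y i"
proof
  assume *: "y (i + 1) = y i"
  have "x i \<in> N (x (i + 1))" "x (i + 2) \<in> N (x (i + 1))" "y i \<in> N (x (i + 1))" "y i \<in> N (x i)"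
    "y i \<in> N (x (i + 2))"
    using sym[OF x_adj[of i]] x_adj[of "i + 1"] y_props[of i] y_props[of "i + 1"] *
    by (simp_all add: numeral_eq_Suc)
  moreover from this have "x i \<in> N v" "x (i + 2) \<in> N (y i)" "v \<in> N (x (i + 2))"
    "v \<in> N (x (i + 1))" using x_in v_in sym by blast+
  ultimately show False
    using no_4_cycle_in_nbhd[of v "x i" "y i" "x (i + 2)" "x (i + 1)"] x_ne(2)[of i] by simp
qed

text \<open>Such a vertex would be adjacent to \<open>x (i + 1)\<close> and
  \<open>x (i + 2)\<close>, so by uniqueness it would also equal \<open>y (i + 1)\<close>.\<close>

lemma y_ne_2: "y (i + 2) \<noteq> y i"
proof
  assume "y (i + 2) = y i"
  then have "y i = y (i + 1)"
    using y_uniq[of "y i" "i + 1"] y_props[of i] y_props[of "i + 2"] by (simp add: numeral_eq_Suc)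
  then show False using y_ne_Suc[of i] by simp
qed

lemma y_ne: "y (i + 1) \<noteq> y i" "y (i + 2) \<noteq> y i" "y (i + 3) \<noteq> y i" "y (i + 4) \<noteq> y i"
  using y_ne_Suc[of i] y_ne_Suc[of "i + 4"] y_ne_2[of i] y_ne_2[of "i + 3"]
  by (simp_all only: shift5 y_period) simp_all

lemma y_in_x: "y (i + 4) \<in> N (x i)"
  using y_props(2)[of "i + 4"] by (simp only: shift5 x_period)

lemma N_x: "N (x i) = {v, x (i + 1), x (i + 4), y i, y (i + 4)}"
proof -
  have "x (i + 4) \<noteq> x (i + 1)" using x_ne(3)[of "i + 1"] by (simp add: add.commute)
  then have "N (x i) = set [v, x (i + 1), x (i + 4), y i, y (i + 4)]"
    using v_in[of i] x_adj[of i] x_adj'[of i] y_props[of i] y_in_x[of i]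
      y_ne(4)[of i] in_V[OF x_in[of i]] by (intro N_eqI) auto
  then show ?thesis by simp
qed

lemma N_v: "N v = {x i, x (i + 1), x (i + 2), x (i + 3), x (i + 4)}"
proof -
  have "distinct [x i, x (i + 1), x (i + 2), x (i + 3), x (i + 4)]"
    using x_ne[of i] x_ne(1,2,3)[of "i + 1"] x_ne(1,2)[of "i + 2"] x_ne(1)[of "i + 3"]
    by (auto simp: numeral_eq_Suc)
  then have "N v = set [x i, x (i + 1), x (i + 2), x (i + 3), x (i + 4)]"
    using x_in v by (intro N_eqI) auto
  then show ?thesis by simp
qed

text \<open>Both vertices lie in \<open>outer v (x (i + 1))\<close>, which is a clique.\<close>

lemma y_adj: "y (i + 1) \<in> N (y i)"
  using outer_clique[of "x (i + 1)" v "y i" "y (i + 1)"] x_in y_props y_notin y_ne(1)[of i]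
  by (auto simp: outer_def)

text \<open>This chord would close a 4-cycle through \<open>x (i + 1)\<close> and
  \<open>x (i + 2)\<close> in the neighbourhood of \<open>y (i + 1)\<close>.\<close>

lemma y_not_adj_2: "y (i + 2) \<notin> N (y i)"
proof
  assume *: "y (i + 2) \<in> N (y i)"
  have "y i \<in> N (y (i + 1))" "x (i + 1) \<in> N (y (i + 1))" "x (i + 2) \<in> N (y (i + 1))"
    "y (i + 2) \<in> N (y (i + 1))"
    using sym[OF y_adj[of i]] y_adj[of "i + 1"] y_props(1,2)[of "i + 1", THEN sym]
    by (simp_all add: numeral_eq_Suc)
  moreover have "x (i + 1) \<in> N (y i)" "x (i + 2) \<in> N (x (i + 1))" "y (i + 2) \<in> N (x (i + 2))"
    using y_props(2)[of i, THEN sym] x_adj[of "i + 1"] y_props[of "i + 2"] by (simp_all add: numeral_eq_Suc)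
  moreover have "y i \<in> N (y (i + 2))" using * sym by blast
  ultimately show False
    using no_4_cycle_in_nbhd[of "y i" "x (i + 1)" "x (i + 2)" "y (i + 2)" "y (i + 1)"] by simp
qed

lemma y_not_adj_3: "y (i + 3) \<notin> N (y i)"
  using y_not_adj_2[of "i + 3"] by (simp only: shift5 y_period sym_iff[of "y (i + 3)"]) simp

lemma y_adj': "y (i + 4) \<in> N (y i)"
  using y_adj[of "i + 4"] sym by (simp only: shift5 y_period)

lemma N_y_ex:
  "\<exists>z. N (y i) = {x i, x (i + 1), y (i + 1), y (i + 4), z} \<and> z \<notin> {x i, x (i + 1), y (i + 1), y (i + 4)}"
proof -
  let ?S = "{x i, x (i + 1), y (i + 1), y (i + 4)}"
  have sub: "?S \<subseteq> N (y i)" using y_props[of i] y_adj[of i] y_adj'[of i] sym by blast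
  have "y (i + 4) \<noteq> y (i + 1)" using y_ne(3)[of "i + 1"] by (simp add: add.commute)
  moreover have "x (i + 1) \<noteq> x i" using x_ne by blast
  ultimately have "card ?S = 4" by (simp add: card_insert_if)
  moreover have "y i \<in> V" using y_props in_V by blast
  ultimately have "card (N (y i) - ?S) = 1"
    using sub degree_5 by (simp add: card_Diff_subset)
  then obtain z where "N (y i) - ?S = {z}" by (auto simp: card_1_singleton_iff)
  then show ?thesis using sub by blast
qed

text \<open>Each \<open>y i\<close> has one neighbour \<open>z i\<close> not yet identified. The
  edge from \<open>y i\<close> to \<open>y (i + 1)\<close> has a second common neighbour besides
  \<open>x (i + 1)\<close>; elimination shows that it is both \<open>z i\<close> and
  \<open>z (i + 1)\<close>. So all \<open>z i\<close> coincide in the opposite pole.\<close>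

lemma apex:
  obtains z where "\<And>i. N (y i) = {x i, x (i + 1), y (i + 1), y (i + 4), z}"
    "\<And>i. z \<noteq> x i" "\<And>i. z \<noteq> y i" "z \<noteq> v" "N z = {y 0, y 1, y 2, y 3, y 4}"
proof -
  obtain z where z: "\<And>i. N (y i) = {x i, x (i + 1), y (i + 1), y (i + 4), z i}"
    "\<And>i. z i \<notin> {x i, x (i + 1), y (i + 1), y (i + 4)}"
    using N_y_ex by metis
  have zy: "y i \<in> N (z i)" for i using z(1)[of i] sym by blast
  have step: "z (i + 1) = z i" for i
  proof -
    have "y (i + 1) \<noteq> y (i + 4)" using y_ne(3)[of "i + 1"] by (simp add: add.commute)
    then have 1: "x i \<notin> N (y (i + 1))"
      using N_x[of i] y_ne(1)[of i] y_notin x_in[of "i + 1"] y_ne_x y_props(3) sym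
      by (metis insert_iff singletonD)
    have 2: "y (i + 4) \<notin> N (y (i + 1))"
      using y_not_adj_3[of "i + 1"] by (simp add: add.commute)
    obtain w where w: "N (y i) \<inter> N (y (i + 1)) = {x (i + 1), w}" "w \<noteq> x (i + 1)"
      using common_other[of "y (i + 1)" "y i" "x (i + 1)"] y_adj[of i] y_props(2)[of i]
        y_props(1)[of "i + 1"] sym by blast
    have "w \<in> N (y i)" "w \<in> N (y (i + 1))" using w by blast+
    then have "w = z i" using z(1)[of i] 1 2 w(2) irrefl by (metis insert_iff singletonD)
    then have "z i \<in> N (y (i + 1))" using w by blast
    moreover have "z i \<noteq> x (i + 2)"
    proof
      assume "z i = x (i + 2)"
      then have "y i \<in> N (x (i + 2))" using zy[of i] by simp
      moreover have "y i \<in> N (x (i + 1))" using y_props by blast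
      ultimately have "y i = y (i + 1)"
        using y_uniq[of "y i" "i + 1"] y_props(3) by (simp add: numeral_eq_Suc)
      then show False using y_ne_Suc[of i] by simp
    qed
    moreover have "z i \<noteq> y (i + 2)" using z(1)[of i] y_not_adj_2[of i] by (metis insertCI)
    moreover have "z i \<noteq> y i" using z(1)[of i] irrefl by (metis insertCI)
    moreover have "i + 1 + 1 = i + 2" "y (i + 1 + 4) = y i" "z i \<noteq> x (i + 1)"
      using z(2)[of i] y_period[of i] by (auto simp: add.commute)
    ultimately show "z (i + 1) = z i" using z(1)[of "i + 1"] by (metis insert_iff singletonD)
  qed
  have const: "z i = z 0" for i by (induction i) (use step in auto)
  let ?z = "z 0"
  have N: "N (y i) = {x i, x (i + 1), y (i + 1), y (i + 4), ?z}" for i using z(1) const by metis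
  have zx: "?z \<noteq> x i" for i using z(2)[of i] const[of i] by auto
  have zne: "?z \<noteq> y i" for i using N[of i] irrefl[of "y i"] by (metis insertCI)
  have "?z \<noteq> v" using zy[of 0] y_notin by metis
  have "distinct [y 0, y 1, y 2, y 3, y 4]"
    using y_ne[of 0] y_ne(1,2,3)[of 1] y_ne(1,2)[of 2] y_ne(1)[of 3] by (auto simp: numeral_eq_Suc)
  moreover have "y i \<in> N ?z" for i using zy const by metis
  moreover have "?z \<in> V" using N[of 0] N_subset[of "y 0"] by blast
  ultimately have "N ?z = set [y 0, y 1, y 2, y 3, y 4]" by (intro N_eqI) auto
  then show thesis using that N zx zne \<open>?z \<noteq> v\<close> by simp
qed

lemma icosahedral_labelling:
  obtains f :: "nat \<Rightarrow> 'a" where "f 0 = v" "inj_on f {..<12}"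
    "\<forall>i<12. N (f i) = f ` {j. (i, j) \<in> parcs icosahedron}"
    "f ` {..<12} \<subseteq> V"
proof -
  obtain z where N_y: "\<And>i. N (y i) = {x i, x (i + 1), y (i + 1), y (i + 4), z}"
    and z: "\<And>i. z \<noteq> x i" "\<And>i. z \<noteq> y i" "z \<noteq> v" and N_z: "N z = {y 0, y 1, y 2, y 3, y 4}"
    using apex by metis
  have period: "x 5 = x 0" "x 6 = x 1" "x 7 = x 2" "x 8 = x 3"
    "y 5 = y 0" "y 6 = y 1" "y 7 = y 2" "y 8 = y 3"
    using x_period[of 0] x_period[of 1] x_period[of 2] x_period[of 3]
      y_period[of 0] y_period[of 1] y_period[of 2] y_period[of 3] by simp_all
  \<comment> \<open>The lower pentagon starts with \<open>y 4\<close>: in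
    \<open>icosahedron\<close>, vertex \<open>1 + i\<close> is joined to \<open>6 + i\<close> and
    its cyclic successor, whereas \<open>x i\<close> is joined to \<open>y (i + 4)\<close> and
    \<open>y i\<close>.\<close>
  define l where "l = [v, x 0, x 1, x 2, x 3, x 4, y 4, y 0, y 1, y 2, y 3, z]"
  have dx: "distinct [x 0, x 1, x 2, x 3, x 4]"
    using x_ne[of 0] x_ne(1,2,3)[of 1] x_ne(1,2)[of 2] x_ne(1)[of 3] by (auto simp: numeral_eq_Suc)
  have dy: "distinct [y 0, y 1, y 2, y 3, y 4]"
    using y_ne[of 0] y_ne(1,2,3)[of 1] y_ne(1,2)[of 2] y_ne(1)[of 3] by (auto simp: numeral_eq_Suc)
  have "distinct l"
    using dx dy z z[symmetric] unfolding l_def by auto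
  then have inj: "inj_on ((!) l) {..<12}"
    by (intro inj_on_nth) (auto simp: l_def)
  have *: "{..<5::nat} = {0, 1, 2, 3, 4}" by auto
  \<comment> \<open>The neighbour lists of the twelve vertices, tabulated so that each can be
    compared with \<open>N_v\<close>, \<open>N_x\<close>, \<open>N_y\<close> or
    \<open>N_z\<close>.\<close>
  have arcs: "{j. (i, j) \<in> parcs icosahedron} =
     [{1, 2, 3, 4, 5}, {0, 2, 5, 6, 7}, {0, 1, 3, 7, 8}, {0, 2, 4, 8, 9}, {0, 3, 5, 9, 10},
      {0, 4, 1, 10, 6}, {1, 5, 7, 10, 11}, {1, 2, 6, 8, 11}, {2, 3, 7, 9, 11}, {3, 4, 8, 10, 11},
      {4, 5, 9, 6, 11}, {6, 7, 8, 9, 10}] ! i"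
    if i: "i \<in> {0,1,2,3,4,5,6,7,8,9,10,11}" for i
    using i unfolding icosahedron_def Let_def *
    by (elim insertE emptyE; simp; auto)
  have nbhd: "N (l ! i) = (!) l ` {j. (i, j) \<in> parcs icosahedron}" if "i < 12" for i
  proof -
    have i: "i \<in> {0,1,2,3,4,5,6,7,8,9,10,11}" using that unfolding insert_iff empty_iff by presburger
    show ?thesis
      unfolding arcs[OF i] l_def using i
      by (elim insertE emptyE; simp add: N_x N_y N_z N_v[of 0] period insert_commute numeral_2_eq_2[symmetric])
  qed
  have "set l \<subseteq> V"
    using v in_V[OF x_in] in_V[OF y_props(1)] N_y[of 0] N_subset[of "y 0"] by (simp add: l_def)
  moreover have "length l = 12" by (simp add: l_def)
  ultimately have sub: "(!) l ` {..<12} \<subseteq> V" using nth_mem[of _ l] by auto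
  have "l ! 0 = v" by (simp add: l_def)
  then show thesis using that[of "(!) l"] inj nbhd sub by blast
qed

end

section \<open>Locally matched graphs\<close>

locale locally_matched = claw_K4_free +
  fixes V :: "'a set"
  assumes fin_V: "finite V"
    and all_matched: "v \<in> V \<Longrightarrow> matched v"
    and N_subset: "N v \<subseteq> V"
begin

definition triangles :: "'a set set" where
  "triangles = {{a, b, c} | a b c. b \<in> N a \<and> c \<in> N a \<and> c \<in> N b}"

definition through :: "'a \<Rightarrow> 'a set set" where
  "through v = {T \<in> triangles. v \<in> T}"

lemma in_V: "x \<in> N v \<Longrightarrow> x \<in> V"
  using N_subset by blast

text \<open>Every edge therefore lies in exactly one triangle.\<close>

lemma common_1: "x \<in> N v \<Longrightarrow> \<exists>w. N v \<inter> N x = {w}"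
  using all_matched[of v] in_V[OF sym] by (auto simp: matched_def card_1_singleton_iff)

lemma triangle_adj:
  assumes "T \<in> triangles" "u \<in> T" "w \<in> T" "u \<noteq> w"
  shows "w \<in> N u"
  using assms by (auto simp: triangles_def sym_iff)

lemma triangle_eq:
  assumes "T \<in> triangles" "u \<in> T" "w \<in> T" "u \<noteq> w"
  shows "T = {u, w} \<union> (N u \<inter> N w)"
proof -
  obtain s where s: "N u \<inter> N w = {s}" using common_1[OF triangle_adj[OF assms]] by blast
  obtain a b c where T: "T = {a, b, c}" "b \<in> N a" "c \<in> N a" "c \<in> N b"
    using assms(1) by (auto simp: triangles_def)
  then have "a \<noteq> b" "a \<noteq> c" "b \<noteq> c" by auto
  with T assms obtain t where t: "T = {u, w, t}" "t \<noteq> u" "t \<noteq> w" by auto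
  then have "t \<in> N u \<inter> N w" using triangle_adj[OF assms(1)] by auto
  then show ?thesis using s t by auto
qed

lemma triangles_Int:
  assumes "S \<in> triangles" "T \<in> triangles" "S \<noteq> T" "u \<in> S" "u \<in> T" "w \<in> S" "w \<in> T"
  shows "u = w"
  using triangle_eq[of S u w] triangle_eq[of T u w] assms by blast

lemma triangle_of_edge:
  assumes "x \<in> N v"
  obtains T where "T \<in> triangles" "v \<in> T" "x \<in> T"
proof -
  obtain s where "N v \<inter> N x = {s}" using common_1[OF assms] by blast
  then have "s \<in> N v" "s \<in> N x" by blast+
  then have "{v, x, s} \<in> triangles" using assms by (auto simp: triangles_def)
  then show thesis using that by blast
qed

lemma triangles_subset: "T \<in> triangles \<Longrightarrow> T \<subseteq> V"
  by (auto simp: triangles_def intro: in_V dest: sym)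

lemma finite_triangles: "finite triangles"
  using finite_subset[of triangles "Pow V"] triangles_subset fin_V by blast

lemma card_triangle: "T \<in> triangles \<Longrightarrow> card T = 3"
  unfolding triangles_def card_3_iff using irrefl by blast

text \<open>The two disjoint edges of \<open>N v\<close> give two triangles meeting only in
  \<open>v\<close>. Their other four vertices exhaust \<open>N v\<close>, so any further triangle
  through \<open>v\<close> would share an edge with one of them and coincide with it.\<close>

lemma card_through:
  assumes "v \<in> V"
  shows "card (through v) = 2"
proof -
  have m: "matched v" using all_matched assms .
  then have "N v \<noteq> {}" by (auto simp: matched_def)
  then obtain a where a: "a \<in> N v" by blast
  obtain S where S: "S \<in> triangles" "v \<in> S" "a \<in> S" using triangle_of_edge[OF a] .
  have "card (N v - (S - {v})) > 0"
    using m card_triangle[OF S(1)] S(2) diff_card_le_card_Diff[of "S - {v}" "N v"]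
    by (simp add: matched_def card_ge_0_finite)
  then obtain b where b: "b \<in> N v" "b \<notin> S"
    by (metis DiffD1 DiffD2 Diff_iff card_gt_0_iff ex_in_conv irrefl singletonD)
  obtain T where T: "T \<in> triangles" "v \<in> T" "b \<in> T" using triangle_of_edge[OF b(1)] .
  have "S \<noteq> T" using b T by blast
  have "S \<inter> T = {v}" using triangles_Int[OF S(1) T(1) \<open>S \<noteq> T\<close>] S T by blast
  then have disj: "(S - {v}) \<inter> (T - {v}) = {}" by blast
  have fin': "finite S" "finite T" using card_triangle S T by (metis card.infinite zero_neq_numeral)+
  have "card ((S - {v}) \<union> (T - {v})) = 4"
    using card_Un_disjoint[OF _ _ disj] fin' card_triangle S T by simp
  moreover have "(S - {v}) \<union> (T - {v}) \<subseteq> N v" using triangle_adj S T by blast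
  ultimately have N: "(S - {v}) \<union> (T - {v}) = N v"
    using m by (intro card_subset_eq) (auto simp: matched_def)
  have "through v = {S, T}"
  proof
    show "{S, T} \<subseteq> through v" using S T by (auto simp: through_def)
    show "through v \<subseteq> {S, T}"
    proof
      fix R assume R: "R \<in> through v"
      then have R': "R \<in> triangles" "v \<in> R" by (auto simp: through_def)
      then have "\<not> R \<subseteq> {v}" using card_triangle[of R] card_mono[of "{v}" R] by auto
      then obtain c where c: "c \<in> R" "c \<noteq> v" by blast
      then have "c \<in> S \<or> c \<in> T" using triangle_adj[OF R', of c] N by blast
      then show "R \<in> {S, T}" using triangles_Int[of R S v c] triangles_Int[of R T v c] R' c S T by blast
    qed
  qed
  then show ?thesis using \<open>S \<noteq> T\<close> by simp
qed

lemma through_eq: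
  assumes "S \<in> triangles" "T \<in> triangles" "S \<noteq> T" "v \<in> S" "v \<in> T"
  shows "through v = {S, T}"
proof -
  have "card (through v) = 2" using card_through triangles_subset assms by blast
  moreover have "{S, T} \<subseteq> through v" using assms by (auto simp: through_def)
  moreover have "card {S, T} = 2" using assms by simp
  ultimately show ?thesis by (metis card_subset_eq card_ge_0_finite zero_less_numeral)
qed

lemma throughE:
  assumes "v \<in> V"
  obtains S T where "through v = {S, T}" "S \<noteq> T" "S \<in> triangles" "T \<in> triangles" "v \<in> S" "v \<in> T"
proof -
  obtain S T where "through v = {S, T}" "S \<noteq> T" using card_through[OF assms] by (auto simp: card_2_iff)
  moreover from this have "S \<in> through v" "T \<in> through v" by auto
  ultimately show thesis using that by (auto simp: through_def)
qed

text \<open>Each of the three vertices of \<open>T\<close> lies in exactly one other triangle, and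
  these are distinct because two triangles share at most one vertex. This is what makes the root
  graph cubic.\<close>

lemma card_adjacent_triangles:
  assumes "T \<in> triangles"
  shows "card {S \<in> triangles. S \<noteq> T \<and> S \<inter> T \<noteq> {}} = 3"
proof -
  have T: "finite T" "card T = 3" using card_triangle[OF assms] by (auto intro: card_ge_0_finite)
  have "{S \<in> triangles. S \<noteq> T \<and> S \<inter> T \<noteq> {}} = (\<Union>v\<in>T. through v - {T})"
    by (auto simp: through_def)
  also have "card \<dots> = (\<Sum>v\<in>T. card (through v - {T}))"
    using T(1) finite_triangles triangles_Int assms
    by (intro card_UN_disjoint) (auto simp: through_def)
  also have "\<dots> = (\<Sum>v\<in>T. 1)"
  proof (rule sum.cong)
    fix v assume "v \<in> T"
    then have "T \<in> through v" "v \<in> V" using assms triangles_subset by (auto simp: through_def)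
    then show "card (through v - {T}) = 1" using card_through[of v] by simp
  qed simp
  finally show ?thesis using T by simp
qed

text \<open>The vertices of \<open>F\<close> are the triangles, joined when they meet; a vertex of
  the original graph becomes the edge between the two triangles through it.\<close>

lemma line_graph_representation:
  obtains F :: "nat pair_pre_digraph" and f :: "'a \<Rightarrow> nat set"
  where "pair_graph F" "regular_graph 3 F" "bij_betw f V (pverts (line_graph F))"
    "\<And>u w. \<lbrakk>u \<in> V; w \<in> V\<rbrakk> \<Longrightarrow> w \<in> N u \<longleftrightarrow> (f u, f w) \<in> parcs (line_graph F)"
proof -
  \<comment> \<open>Naming triangles by naturals puts \<open>F\<close> on a fixed vertex
    type.\<close>
  obtain h :: "'a set \<Rightarrow> nat" where h: "inj_on h triangles"
    using finite_imp_inj_to_nat_seg[OF finite_triangles] by blast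
  define R where "R = {(S, T). S \<in> triangles \<and> T \<in> triangles \<and> S \<noteq> T \<and> S \<inter> T \<noteq> {}}"
  define F where "F = \<lparr>pverts = h ` triangles, parcs = map_prod h h ` R\<rparr>"
  define f where "f v = h ` through v" for v
  have "finite R"
    using finite_subset[of R "triangles \<times> triangles"] finite_triangles by (auto simp: R_def)
  have pg: "pair_graph F"
  proof
    show "finite (pverts F)" "finite (parcs F)"
      using finite_triangles \<open>finite R\<close> by (auto simp: F_def)
    have ends: "fst e \<in> pverts F \<and> snd e \<in> pverts F \<and> fst e \<noteq> snd e" if "e \<in> parcs F" for e
    proof -
      obtain S T where "e = (h S, h T)" "(S, T) \<in> R" using \<open>e \<in> parcs F\<close> by (auto simp: F_def)
      then show ?thesis using inj_on_eq_iff[OF h, of S T] by (simp add: F_def R_def)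
    qed
    show "fst e \<in> pverts F" "snd e \<in> pverts F" "fst e \<noteq> snd e" if "e \<in> parcs F" for e
      using ends[OF that] by simp_all
    have "(T, S) \<in> R" if "(S, T) \<in> R" for S T using that by (auto simp: R_def)
    then show "symmetric F"
      by (fastforce simp: symmetric_def F_def intro!: symI)
  qed
  have reg: "regular_graph 3 F"
    unfolding regular_graph_def
  proof
    fix t assume "t \<in> verts F"
    then obtain T where T: "T \<in> triangles" "t = h T" by (auto simp: F_def)
    let ?A = "{S \<in> triangles. S \<noteq> T \<and> S \<inter> T \<noteq> {}}"
    have "(h T, h S) \<in> parcs F" if "S \<in> ?A" for S
      using that T(1) by (auto simp: F_def R_def intro!: image_eqI[where x = "(T, S)"])
    moreover have "\<exists>S \<in> ?A. e = (h T, h S)" if "e \<in> parcs F" "fst e = h T" for e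
    proof -
      obtain S' S where "e = (h S', h S)" "(S', S) \<in> R" using \<open>e \<in> parcs F\<close> by (auto simp: F_def)
      then show ?thesis using \<open>fst e = h T\<close> inj_on_eq_iff[OF h, of S' T] T(1)
        by (auto simp: R_def)
    qed
    moreover have "out_arcs F t = {e \<in> parcs F. fst e = h T}" using T(2) by (simp add: out_arcs_def)
    ultimately have "out_arcs F t = (\<lambda>S. (h T, h S)) ` ?A" by fastforce
    moreover have "inj_on (\<lambda>S. (h T, h S)) ?A" using h by (auto simp: inj_on_def)
    ultimately show "out_degree F t = 3"
      using card_adjacent_triangles[OF T(1)] by (simp add: out_degree_def card_image)
  qed
  have edges: "edge_set F = f ` V"
  proof
    show "edge_set F \<subseteq> f ` V"
    proof
      fix e assume "e \<in> edge_set F"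
      then obtain S T v where "e = {h S, h T}" "S \<in> triangles" "T \<in> triangles" "S \<noteq> T" "v \<in> S" "v \<in> T"
        by (auto simp: edge_set_def F_def R_def)
      moreover from this have "e = f v" using through_eq[of S T v] by (simp add: f_def)
      ultimately show "e \<in> f ` V" using triangles_subset by blast
    qed
    show "f ` V \<subseteq> edge_set F"
    proof
      fix e assume "e \<in> f ` V"
      then obtain v where v: "v \<in> V" "e = f v" by blast
      obtain S T where ST: "through v = {S, T}" "S \<noteq> T" "S \<in> triangles" "T \<in> triangles" "v \<in> S" "v \<in> T"
        using throughE[OF v(1)] .
      then have "(S, T) \<in> R" by (auto simp: R_def)
      then have "(h S, h T) \<in> parcs F" by (force simp: F_def)
      moreover have "e = {h S, h T}" using v ST by (simp add: f_def)
      ultimately show "e \<in> edge_set F" by (auto simp: edge_set_def)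
    qed
  qed
  \<comment> \<open>Two distinct triangles meet in at most one vertex, so the pair of triangles
    through a vertex determines it.\<close>
  have inj: "inj_on f V"
  proof
    fix v w assume vw: "v \<in> V" "w \<in> V" "f v = f w"
    then have eq: "through v = through w"
      using inj_on_image_eq_iff[OF h, of "through v" "through w"] by (auto simp: f_def through_def)
    obtain S T where "through v = {S, T}" "S \<noteq> T" "S \<in> triangles" "T \<in> triangles" "v \<in> S" "v \<in> T"
      using throughE[OF vw(1)] .
    moreover from this eq have "S \<in> through w" "T \<in> through w" by auto
    ultimately show "v = w" using triangles_Int[of S T v w] by (auto simp: through_def)
  qed
  have adj: "w \<in> N u \<longleftrightarrow> (f u, f w) \<in> parcs (line_graph F)" if "u \<in> V" "w \<in> V" for u w
  proof -
    \<comment> \<open>Edges of \<open>F\<close> share an end exactly when the two vertices lie in a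
      common triangle, which for distinct vertices means adjacency.\<close>
    have "f u \<inter> f w = h ` (through u \<inter> through w)"
      unfolding f_def using h by (subst inj_on_image_Int[OF h]) (auto simp: through_def)
    then have "(f u, f w) \<in> parcs (line_graph F) \<longleftrightarrow> u \<noteq> w \<and> through u \<inter> through w \<noteq> {}"
      using that inj edges by (auto simp: line_graph_def inj_on_def)
    also have "\<dots> \<longleftrightarrow> w \<in> N u"
    proof
      assume "u \<noteq> w \<and> through u \<inter> through w \<noteq> {}"
      then show "w \<in> N u" using triangle_adj by (auto simp: through_def)
    next
      assume *: "w \<in> N u"
      obtain T where "T \<in> triangles" "u \<in> T" "w \<in> T" using triangle_of_edge[OF *] .
      then show "u \<noteq> w \<and> through u \<inter> through w \<noteq> {}" using * irrefl by (auto simp: through_def)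
    qed
    finally show ?thesis by blast
  qed
  have "bij_betw f V (pverts (line_graph F))"
    using inj edges by (simp add: bij_betw_def line_graph_def)
  then show thesis using that pg reg adj by blast
qed

end

section \<open>Graphs as pair digraphs\<close>

text \<open>An arc is the pair of its ends, so the arc part of the isomorphism is forced to be
  \<open>map_prod f f\<close>.\<close>

lemma digraph_iso_pairI:
  assumes "pair_wf_digraph G" "pair_wf_digraph H"
    and f: "bij_betw f (pverts G) (pverts H)"
    and arcs: "\<And>u w. \<lbrakk>u \<in> pverts G; w \<in> pverts G\<rbrakk> \<Longrightarrow> (u, w) \<in> parcs G \<longleftrightarrow> (f u, f w) \<in> parcs H"
  shows "digraph_iso (with_proj G) (with_proj H)"
proof -
  interpret G: pair_wf_digraph G by fact
  interpret H: pair_wf_digraph H by fact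
  let ?h = "\<lparr>iso_verts = f, iso_arcs = map_prod f f, iso_head = snd, iso_tail = fst\<rparr>"
  have inj: "inj_on f (pverts G)" and img: "f ` pverts G = pverts H"
    using f by (auto simp: bij_betw_def)
  have sub: "parcs G \<subseteq> pverts G \<times> pverts G" using G.wellformed' by auto
  have "inj_on (map_prod f f) (parcs G)"
    using inj_on_subset[OF map_prod_inj_on[OF inj inj] sub] .
  moreover have "wf_digraph (with_proj G)" by unfold_locales
  ultimately have "pre_digraph.digraph_isomorphism (with_proj G) ?h"
    using inj by (simp add: pre_digraph.digraph_isomorphism_def)
  moreover have "parcs H = map_prod f f ` parcs G"
  proof
    show "map_prod f f ` parcs G \<subseteq> parcs H" using sub arcs by auto
    show "parcs H \<subseteq> map_prod f f ` parcs G"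
    proof
      fix e assume e: "e \<in> parcs H"
      then have "fst e \<in> f ` pverts G" "snd e \<in> f ` pverts G"
        using H.arc_fst_in_verts H.arc_snd_in_verts img by simp_all
      then obtain u w where uw: "u \<in> pverts G" "w \<in> pverts G" "fst e = f u" "snd e = f w" by blast
      then have "e = map_prod f f (u, w)" by (simp add: prod_eq_iff)
      moreover from this have "(u, w) \<in> parcs G" using arcs[of u w] uw e by simp
      ultimately show "e \<in> map_prod f f ` parcs G" by blast
    qed
  qed
  then have "with_proj H = app_iso ?h (with_proj G)"
    using img by (simp add: app_iso_def with_proj_def)
  ultimately show ?thesis by (auto simp: digraph_iso_def)
qed

lemma (in wf_digraph) graph_dist_le_2D:
  assumes "graph_dist G u v \<le> 2" "u \<noteq> v"
  shows "u \<rightarrow>\<^bsub>G\<^esub> v \<or> (\<exists>w. u \<rightarrow>\<^bsub>G\<^esub> w \<and> w \<rightarrow>\<^bsub>G\<^esub> v)"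
proof -
  \<comment> \<open>The distance is an infimum of walk costs. Passing to a strict bound yields an
    actual walk below 3 without showing that the infimum is attained; unit costs then leave at most
    two arcs.\<close>
  have "graph_dist G u v < 3"
    using assms(1) by (rule le_less_trans) simp
  then obtain p where p: "awalk u p v" "ereal (awalk_cost (\<lambda>_. 1) p) < 3"
    by (auto simp: graph_dist_def \<mu>_def INF_less_iff)
  have "awalk_cost (\<lambda>_. 1) p = real (length p)" by (induction p) simp_all
  then have "length p < 3" using p(2) by simp
  moreover have "p \<noteq> []" using p(1) assms(2) by (auto simp: awalk_Nil_iff)
  ultimately consider a where "p = [a]" | a b where "p = [a, b]"
    by (cases p rule: remdups_adj.cases) (auto simp: less_Suc_eq numeral_3_eq_3)
  then show ?thesis
  proof cases
    case 1
    then show ?thesis using p(1) in_arcs_imp_in_arcs_ends by (auto simp: awalk_simps)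
  next
    case 2
    then show ?thesis using p(1) in_arcs_imp_in_arcs_ends by (metis awalk_Cons_iff awalk_Nil_iff)
  qed
qed

lemma (in wf_digraph) graph_dist_adjacent:
  assumes "u \<rightarrow>\<^bsub>G\<^esub> v"
  shows "graph_dist G u v \<le> 1"
proof -
  obtain a where "a \<in> arcs G" "tail G a = u" "head G a = v"
    using assms by (auto simp: arcs_ends_conv)
  then have "awalk u [a] v" by (auto simp: awalk_simps)
  then have "graph_dist G u v \<le> ereal (awalk_cost (\<lambda>_. 1) [a])"
    unfolding graph_dist_def \<mu>_def by (intro INF_lower) simp
  then show ?thesis by (simp add: one_ereal_def)
qed

lemma induce_subgraph_with_proj:
  "with_proj G \<restriction> C = with_proj \<lparr>pverts = C, parcs = parcs G \<inter> C \<times> C\<rparr>"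
  by (auto simp: induce_subgraph_def with_proj_def)

lemma induces_clique_iff:
  assumes "\<And>u. (u, u) \<notin> parcs G"
  shows "induces_clique (with_proj G) C
    \<longleftrightarrow> C \<subseteq> pverts G \<and> finite C \<and> (\<forall>u\<in>C. \<forall>w\<in>C. u \<noteq> w \<longrightarrow> (u, w) \<in> parcs G)"
proof -
  have "parcs G \<inter> C \<times> C = {(u, w). (u, w) \<in> C \<times> C \<and> u \<noteq> w}
    \<longleftrightarrow> (\<forall>u\<in>C. \<forall>w\<in>C. u \<noteq> w \<longrightarrow> (u, w) \<in> parcs G)"
  proof
    assume "parcs G \<inter> C \<times> C = {(u, w). (u, w) \<in> C \<times> C \<and> u \<noteq> w}"
    then show "\<forall>u\<in>C. \<forall>w\<in>C. u \<noteq> w \<longrightarrow> (u, w) \<in> parcs G" by blast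
  next
    assume "\<forall>u\<in>C. \<forall>w\<in>C. u \<noteq> w \<longrightarrow> (u, w) \<in> parcs G"
    then show "parcs G \<inter> C \<times> C = {(u, w). (u, w) \<in> C \<times> C \<and> u \<noteq> w}"
      by (auto simp: assms)
  qed
  then show ?thesis
    unfolding induces_clique_def induce_subgraph_with_proj complete_digraph_pair_def by simp
qed

section \<open>From finite simple graphs to neighbourhood functions\<close>

context pair_graph
begin

lemma open_nbhd_iff [simp]: "u \<in> open_nbhd G v \<longleftrightarrow> (v, u) \<in> parcs G"
  by (simp add: open_nbhd_def)

lemma claw_free_imp:
  assumes "claw_free G" "a \<in> open_nbhd G v" "b \<in> open_nbhd G v" "c \<in> open_nbhd G v"
    "a \<noteq> b" "a \<noteq> c" "b \<noteq> c"
  shows "b \<in> open_nbhd G a \<or> c \<in> open_nbhd G a \<or> c \<in> open_nbhd G b"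
proof (rule ccontr)
  assume n: "\<not> ?thesis"
  let ?S = "{v, a, b, c}"
  have S: "?S \<subseteq> pverts G" using assms wellformed' by auto
  then have induced: "induced_subgraph (G \<restriction> ?S) G" using induced_induce by simp
  have "v \<noteq> a" "v \<noteq> b" "v \<noteq> c" using assms no_loops' by auto
  have "(s, t) \<notin> parcs G" if "s \<in> {a, b, c}" "t \<in> {a, b, c}" for s t
  proof -
    have "(s, t) \<in> {(a, b), (b, a), (a, c), (c, a), (b, c), (c, b)} \<or> s = t" using that by blast
    then show ?thesis using n no_loops'[of s t] arcs_symmetric[of s t] by auto
  qed
  moreover have "(v, v) \<notin> parcs G" using no_loops' by blast
  moreover have "(v, s) \<in> parcs G" "(s, v) \<in> parcs G" if "s \<in> {a, b, c}" for s
    using that assms(2-4) arcs_symmetric[of v s] by auto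
  ultimately have arcs: "parcs G \<inter> ?S \<times> ?S = {v} \<times> {a, b, c} \<union> {a, b, c} \<times> {v}"
    by auto
  \<comment> \<open>The sides of the claw are \<open>{v}\<close> and \<open>{a, b, c}\<close>;
    spelling out the whole conjunction lets \<open>exI\<close> find both by unification.\<close>
  have "?S = {v} \<union> {a, b, c} \<and> {v} \<inter> {a, b, c} = {} \<and> card {v} = 1 \<and> card {a, b, c} = 3
    \<and> {v} \<times> {a, b, c} \<union> {a, b, c} \<times> {v} = {v} \<times> {a, b, c} \<union> {a, b, c} \<times> {v}"
    using assms(5-7) \<open>v \<noteq> a\<close> \<open>v \<noteq> b\<close> \<open>v \<noteq> c\<close> by (simp add: insert_commute)
  then have "\<exists>U W. ?S = U \<union> W \<and> U \<inter> W = {} \<and> card U = 1 \<and> card W = 3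
    \<and> {v} \<times> {a, b, c} \<union> {a, b, c} \<times> {v} = U \<times> W \<union> W \<times> U"
    by (intro exI)
  then have "K\<^bsub>1,3\<^esub> (G \<restriction> ?S)"
    unfolding induce_subgraph_with_proj complete_bipartite_digraph_pair_def
      pair_pre_digraph.simps arcs by simp
  then show False using induced assms(1) by (auto simp: claw_free_def)
qed

lemma clique_iff:
  "induces_clique G C \<longleftrightarrow> C \<subseteq> pverts G \<and> (\<forall>u\<in>C. \<forall>w\<in>C. u \<noteq> w \<longrightarrow> (u, w) \<in> parcs G)"
proof -
  have "(u, u) \<notin> parcs G" for u using no_loops'[of u u] by blast
  moreover have "finite C" if "C \<subseteq> pverts G" using finite_subset[OF that pair_finite_verts] .
  ultimately show ?thesis using induces_clique_iff[of G C] by blast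
qed

lemma finite_clique_cards: "finite {card C | C. induces_clique G C}"
proof (rule finite_subset)
  show "{card C | C. induces_clique G C} \<subseteq> {..card (pverts G)}"
    using card_mono[OF pair_finite_verts] by (auto simp: clique_iff)
qed simp

lemma clique_card_le: "induces_clique G C \<Longrightarrow> card C \<le> clique_number G"
  unfolding clique_number_def by (rule Max_ge[OF finite_clique_cards]) blast

lemma clique_number_witness:
  obtains C where "induces_clique G C" "card C = clique_number G"
proof -
  \<comment> \<open>The empty clique makes the set under \<open>Max\<close> nonempty.\<close>
  have "induces_clique G {}" by (simp add: clique_iff)
  then have "clique_number G \<in> {card C | C. induces_clique G C}"
    unfolding clique_number_def by (intro Max_in finite_clique_cards) blast
  then show thesis using that by auto
qed

text \<open>The form in which connectedness is used. It is defined through the symmetric closure,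
  which for a symmetric graph has the same reachability relation.\<close>

lemma connected_subset:
  assumes "Digraph_Component.connected G" "u \<in> S" "u \<in> pverts G"
    and closed: "\<And>x y. \<lbrakk>x \<in> S; (x, y) \<in> parcs G\<rbrakk> \<Longrightarrow> y \<in> S"
  shows "pverts G \<subseteq> S"
proof
  fix w assume "w \<in> pverts G"
  then have "u \<rightarrow>\<^sup>*\<^bsub>with_proj (mk_symmetric G)\<^esub> w"
    using assms by (auto simp: connected_def strongly_connected_def mk_symmetric_def)
  then have "u \<rightarrow>\<^sup>*\<^bsub>G\<^esub> w" using reachable_mk_symmetric_eq[OF pair_sym_arcs] by simp
  then show "w \<in> S"
  proof (induction rule: reachable_induct)
    case base
    then show ?case using assms by simp
  next
    case (step x y)
    then show ?case using closed by simp
  qed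
qed

lemma claw_K4_free:
  assumes "claw_free G" "clique_number G \<le> 3"
  shows "claw_K4_free (open_nbhd G)"
proof
  show "finite (open_nbhd G v)" for v
    by (rule finite_subset[OF _ pair_finite_verts]) (auto simp: wellformed')
  show "u \<in> open_nbhd G v \<Longrightarrow> v \<in> open_nbhd G u" for u v using arcs_symmetric by simp
  show "v \<notin> open_nbhd G v" for v using no_loops' by auto
  show "b \<in> open_nbhd G a \<or> c \<in> open_nbhd G a \<or> c \<in> open_nbhd G b"
    if "a \<in> open_nbhd G v" "b \<in> open_nbhd G v" "c \<in> open_nbhd G v" "a \<noteq> b" "a \<noteq> c" "b \<noteq> c"
    for a b c v using claw_free_imp[OF assms(1) that] .
  show False if "a \<in> open_nbhd G v" "b \<in> open_nbhd G v" "c \<in> open_nbhd G v"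
    "b \<in> open_nbhd G a" "c \<in> open_nbhd G a" "c \<in> open_nbhd G b" for a b c v
  proof -
    have "v \<noteq> a" "v \<noteq> b" "v \<noteq> c" "a \<noteq> b" "a \<noteq> c" "b \<noteq> c" using that no_loops' by auto
    then have "card {v, a, b, c} = 4" by simp
    moreover have "(a, v) \<in> parcs G" "(b, v) \<in> parcs G" "(c, v) \<in> parcs G" "(b, a) \<in> parcs G"
      "(c, a) \<in> parcs G" "(c, b) \<in> parcs G"
      using that arcs_symmetric by simp_all
    then have "induces_clique G {v, a, b, c}"
      using that wellformed' by (auto simp: clique_iff)
    ultimately show False using clique_card_le assms(2) by force
  qed
qed

text \<open>A vertex within distance two is a neighbour or lies in \<open>sphere2\<close>; only this
  inclusion is needed for upper bounds.\<close>

lemma out_degree_square_le: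
  assumes "claw_K4_free (open_nbhd G)"
  shows "out_degree (graph_square G) v
    \<le> card (open_nbhd G v) + card (claw_K4_free.sphere2 (open_nbhd G) v)"
proof -
  interpret N: claw_K4_free "open_nbhd G" by fact
  have "out_arcs (graph_square G) v \<subseteq> Pair v ` (open_nbhd G v \<union> N.sphere2 v)"
  proof
    fix e assume "e \<in> out_arcs (graph_square G) v"
    then obtain u where u: "e = (v, u)" "v \<noteq> u" "graph_dist G v u \<le> 2"
      by (auto simp: out_arcs_def graph_square_def)
    then have "u \<in> open_nbhd G v \<or> (\<exists>w \<in> open_nbhd G v. u \<in> open_nbhd G w)"
      using graph_dist_le_2D[of v u] by auto
    then have "u \<in> open_nbhd G v \<union> N.sphere2 v"
      using u(2) by (auto simp: N.sphere2_def N.outer_def)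
    then show "e \<in> Pair v ` (open_nbhd G v \<union> N.sphere2 v)" using u(1) by blast
  qed
  then have "out_degree (graph_square G) v \<le> card (Pair v ` (open_nbhd G v \<union> N.sphere2 v))"
    unfolding out_degree_def by (intro card_mono) auto
  also have "\<dots> = card (open_nbhd G v \<union> N.sphere2 v)"
    by (intro card_image) (simp add: inj_on_def)
  finally show ?thesis using card_Un_le le_trans by blast
qed

lemma icosahedron_iso:
  assumes "Digraph_Component.connected G" "claw_K4_free (open_nbhd G)" "pverts G \<noteq> {}"
    and deg: "\<And>v. v \<in> pverts G \<Longrightarrow> card (open_nbhd G v) = 5"
  shows "digraph_iso G icosahedron"
proof -
  interpret claw_K4_free "open_nbhd G" by fact
  interpret L: locally_pentagonal "open_nbhd G" "pverts G"
    using deg by unfold_locales (auto simp: wellformed')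
  obtain v where v: "v \<in> pverts G" using assms(3) by blast
  obtain x where "\<And>i::nat. x (i + 5) = x i" "\<And>i. x i \<in> open_nbhd G v"
    "\<And>i. x (i + 1) \<in> open_nbhd G (x i)" "\<And>i. x (i + 2) \<noteq> x i"
    using L.nbhd_5_cycle[OF v] by metis
  then interpret P: pentagonal_link "open_nbhd G" "pverts G" v x
    using v by unfold_locales
  obtain f :: "nat \<Rightarrow> 'a" where f: "f 0 = v" "inj_on f {..<12}"
    "\<forall>i<12. open_nbhd G (f i) = f ` {j. (i, j) \<in> parcs icosahedron}"
    "f ` {..<12} \<subseteq> pverts G"
    using P.icosahedral_labelling .
  have lt: "i < 12 \<and> j < 12" if "(i, j) \<in> parcs icosahedron" for i j
    using that by (auto simp: icosahedron_def Let_def)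
  have verts: "pverts icosahedron = {..<12}" by (simp add: icosahedron_def Let_def)
  have wf: "pair_wf_digraph icosahedron"
    using lt by unfold_locales (auto simp: verts)
  \<comment> \<open>The twelve labelled vertices are closed under adjacency, so connectedness leaves
    no others.\<close>
  have "pverts G \<subseteq> f ` {..<12}"
  proof (rule connected_subset[OF assms(1) _ v])
    show "v \<in> f ` {..<12}" using f(1) by force
    show "y \<in> f ` {..<12}" if "x \<in> f ` {..<12}" "(x, y) \<in> parcs G" for x y
    proof -
      obtain i where i: "i < 12" "x = f i" using \<open>x \<in> f ` {..<12}\<close> by blast
      have "y \<in> open_nbhd G (f i)" using that(2) i(2) by simp
      then obtain j where "y = f j" "(i, j) \<in> parcs icosahedron" using f(3) i(1) by auto
      then show ?thesis using lt by simp
    qed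
  qed
  then have bij: "bij_betw f {..<12} (pverts G)"
    using f(2,4) by (simp add: bij_betw_def subset_antisym)
  have adj: "(i, j) \<in> parcs icosahedron \<longleftrightarrow> (f i, f j) \<in> parcs G" if "i < 12" "j < 12" for i j
  proof -
    have N: "open_nbhd G (f i) = f ` {j. (i, j) \<in> parcs icosahedron}" using f(3) that(1) by blast
    have "(f i, f j) \<in> parcs G \<longleftrightarrow> f j \<in> f ` {j. (i, j) \<in> parcs icosahedron}"
      unfolding N[symmetric] by simp
    also have "\<dots> \<longleftrightarrow> (i, j) \<in> parcs icosahedron"
      using inj_on_image_mem_iff[OF f(2), of j "{j. (i, j) \<in> parcs icosahedron}"] that lt by auto
    finally show ?thesis by simp
  qed
  \<comment> \<open>The labelling maps the icosahedron into \<open>G\<close>; the required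
    isomorphism goes the other way.\<close>
  let ?g = "the_inv_into {..<12} f"
  have g: "bij_betw ?g (pverts G) {..<12}" using bij_betw_the_inv_into[OF bij] .
  show ?thesis
  proof (rule digraph_iso_pairI)
    show "pair_wf_digraph G" by unfold_locales
    show "(u, w) \<in> parcs G \<longleftrightarrow> (?g u, ?g w) \<in> parcs icosahedron" if "u \<in> pverts G" "w \<in> pverts G" for u w
    proof -
      have "f (?g u) = u" "f (?g w) = w" using f_the_inv_into_f_bij_betw[OF bij] that by blast+
      moreover have "?g u < 12" "?g w < 12" using bij_betwE[OF g] that by auto
      ultimately show ?thesis using adj[of "?g u" "?g w"] by simp
    qed
  qed (use wf g verts in auto)
qed

lemma line_graph_iso:
  assumes "claw_K4_free (open_nbhd G)"
    and "\<And>v. v \<in> pverts G \<Longrightarrow> claw_K4_free.matched (open_nbhd G) v"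
  shows "\<exists>F :: nat pair_pre_digraph. pair_graph F \<and> regular_graph 3 F \<and> digraph_iso G (line_graph F)"
proof -
  interpret claw_K4_free "open_nbhd G" by fact
  interpret L: locally_matched "open_nbhd G" "pverts G"
    using assms(2) pair_finite_verts by unfold_locales (auto simp: wellformed')
  obtain F :: "nat pair_pre_digraph" and f where F: "pair_graph F" "regular_graph 3 F"
    "bij_betw f (pverts G) (pverts (line_graph F))"
    "\<And>u w. \<lbrakk>u \<in> pverts G; w \<in> pverts G\<rbrakk>
      \<Longrightarrow> w \<in> open_nbhd G u \<longleftrightarrow> (f u, f w) \<in> parcs (line_graph F)"
    using L.line_graph_representation by metis
  have "digraph_iso G (line_graph F)"
  proof (rule digraph_iso_pairI)
    show "pair_wf_digraph G" by unfold_locales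
    show "pair_wf_digraph (line_graph F)" by unfold_locales (auto simp: line_graph_def)
    show "(u, w) \<in> parcs G \<longleftrightarrow> (f u, f w) \<in> parcs (line_graph F)" if "u \<in> pverts G" "w \<in> pverts G" for u w
      using F(4)[OF that] by simp
  qed (rule F)
  then show ?thesis using F by blast
qed

text \<open>The edge from \<open>a\<close> to \<open>b\<close> survives the deletion of
  \<open>v\<close>, so they remain at distance at most 1.\<close>

lemma del_vert_square_clique:
  assumes "(v, a) \<in> parcs G" "(v, b) \<in> parcs G" "(a, b) \<in> parcs G"
  shows "induces_clique (graph_square (pre_digraph.del_vert G v)) {a, b}"
proof -
  let ?H = "pre_digraph.del_vert G v"
  interpret H: wf_digraph ?H by (rule wf_digraph_del_vert)
  have ne: "a \<noteq> v" "b \<noteq> v" "a \<noteq> b" using assms no_loops' by auto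
  have sym: "(b, a) \<in> parcs G" using assms arcs_symmetric by blast
  have adj: "(s, t) \<in> arcs_ends ?H" if "(s, t) \<in> parcs G" "s \<noteq> v" "t \<noteq> v" for s t
    using that by (force simp: pre_digraph.del_vert_def arcs_ends_conv)
  have "graph_dist ?H s t \<le> 2" if "(s, t) \<in> parcs G" "s \<noteq> v" "t \<noteq> v" for s t
    using H.graph_dist_adjacent[OF adj[OF that]] by (rule order_trans) simp
  then show ?thesis
    using assms ne sym wellformed'
    by (subst induces_clique_iff) (auto simp: graph_square_def pre_digraph.del_vert_def)
qed

section \<open>Assembling the three alternatives\<close>

lemma square_degrees_at_ordinary_vertex:
  assumes cf: "claw_K4_free (open_nbhd G)" and nonempty: "open_nbhd G v \<noteq> {}"
    and v: "\<not> claw_K4_free.matched (open_nbhd G) v" "card (open_nbhd G v) \<noteq> 5"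
  shows "out_degree (graph_square G) v \<le> 9"
    and "\<forall>x \<in> open_nbhd G v. out_degree (graph_square G) x \<le> 11"
    and "(\<exists>x \<in> open_nbhd G v. out_degree (graph_square G) x \<le> 10)
      \<or> induces_clique (graph_square (pre_digraph.del_vert G v)) (open_nbhd G v)"
proof -
  interpret N: claw_K4_free "open_nbhd G" by (rule cf)
  note deg = out_degree_square_le[OF cf]
  show "out_degree (graph_square G) v \<le> 9"
    using deg[of v] N.degree_square_le_9[OF v] by simp
  show "\<forall>x \<in> open_nbhd G v. out_degree (graph_square G) x \<le> 11"
    using deg N.degree_square_le_11[OF v] le_trans by blast
  show "(\<exists>x \<in> open_nbhd G v. out_degree (graph_square G) x \<le> 10)
      \<or> induces_clique (graph_square (pre_digraph.del_vert G v)) (open_nbhd G v)"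
  proof (cases "\<exists>x \<in> open_nbhd G v. \<not> N.matched x")
    case True
    then show ?thesis using deg N.degree_square_le_10 le_trans by blast
  next
    case False
    then obtain a b where "open_nbhd G v = {a, b}" "b \<in> open_nbhd G a"
      using N.all_neighbours_matched[OF v(1) nonempty] by blast
    moreover from this have "(v, a) \<in> parcs G" "(v, b) \<in> parcs G" "(a, b) \<in> parcs G"
      by (metis open_nbhd_iff insertCI)+
    ultimately show ?thesis using del_vert_square_clique[of v a b] by simp
  qed
qed

text \<open>A neighbour of a matched vertex cannot have degree 5, so it is matched again; the
  matched vertices are thus closed under adjacency.\<close>

lemma all_matched_or_all_degree_5:
  assumes conn: "Digraph_Component.connected G" and cf: "claw_K4_free (open_nbhd G)"
    and dich: "\<And>v. v \<in> pverts G
      \<Longrightarrow> claw_K4_free.matched (open_nbhd G) v \<or> card (open_nbhd G v) = 5"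
  shows "(\<forall>v \<in> pverts G. claw_K4_free.matched (open_nbhd G) v)
    \<or> (\<forall>v \<in> pverts G. card (open_nbhd G v) = 5)"
proof -
  interpret N: claw_K4_free "open_nbhd G" by (rule cf)
  have "pverts G \<subseteq> {u. N.matched u}" if a: "a \<in> pverts G" "N.matched a" for a
  proof (rule connected_subset[OF conn _ a(1)])
    show "a \<in> {u. N.matched u}" using a by simp
    show "y \<in> {u. N.matched u}" if "x \<in> {u. N.matched u}" "(x, y) \<in> parcs G" for x y
      using that dich[of y] in_arcsD2 N.matched_adjacent_degree_5[of x y] arcs_symmetric[of x y]
      by auto
  qed
  then show ?thesis using dich by blast
qed

text \<open>An isolated vertex would be the whole connected graph, whose cliques have at most one
  vertex.\<close>

lemma open_nbhd_nonempty:
  assumes "Digraph_Component.connected G" "2 \<le> clique_number G" "v \<in> pverts G"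
  shows "open_nbhd G v \<noteq> {}"
proof
  assume "open_nbhd G v = {}"
  then have "pverts G \<subseteq> {v}" using assms(3) by (intro connected_subset[OF assms(1)]) auto
  moreover obtain C where "induces_clique G C" "card C = clique_number G"
    by (rule clique_number_witness)
  ultimately show False
    using assms(2) card_mono[of "{v}" C] by (auto simp: clique_iff)
qed

lemma icosahedron_or_line_graph_or_ordinary_vertex:
  assumes "Digraph_Component.connected G" "claw_free G" "clique_number G = 3"
  shows "digraph_iso G icosahedron
    \<or> (\<exists>F :: nat pair_pre_digraph.
          pair_graph F \<and> regular_graph 3 F \<and> digraph_iso G (line_graph F))
    \<or> (\<exists>v \<in> pverts G.
          out_degree (graph_square G) v \<le> 9
        \<and> (\<forall>x \<in> open_nbhd G v. out_degree (graph_square G) x \<le> 11)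
        \<and> ((\<exists>x \<in> open_nbhd G v. out_degree (graph_square G) x \<le> 10)
           \<or> induces_clique (graph_square (pre_digraph.del_vert G v)) (open_nbhd G v)))"
proof -
  have cf: "claw_K4_free (open_nbhd G)" using claw_K4_free assms(2,3) by simp
  have nonempty: "open_nbhd G v \<noteq> {}" if "v \<in> pverts G" for v
    using open_nbhd_nonempty[OF assms(1) _ that] assms(3) by simp
  show ?thesis
  proof (cases "\<exists>v \<in> pverts G. \<not> claw_K4_free.matched (open_nbhd G) v \<and> card (open_nbhd G v) \<noteq> 5")
    case True
    then show ?thesis using square_degrees_at_ordinary_vertex[OF cf nonempty] by blast
  next
    case False
    then consider "\<forall>v \<in> pverts G. claw_K4_free.matched (open_nbhd G) v"
      | "\<forall>v \<in> pverts G. card (open_nbhd G v) = 5"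
      using all_matched_or_all_degree_5[OF assms(1) cf] by blast
    then show ?thesis
    proof cases
      case 1
      then show ?thesis using line_graph_iso[OF cf] by blast
    next
      case 2
      moreover have "pverts G \<noteq> {}"
        using assms(1) by (auto simp: connected_def strongly_connected_def mk_symmetric_def)
      ultimately show ?thesis using icosahedron_iso[OF assms(1) cf] by blast
    qed
  qed
qed

end

theorem theorem4p1:
  fixes G :: "'a pair_pre_digraph"
  assumes "pair_graph G"
    and "Digraph_Component.connected G"
    and "claw_free G"
    and "clique_number G = 3"
  shows "digraph_iso G icosahedron
    \<or> (\<exists>F :: nat pair_pre_digraph.
          pair_graph F \<and> regular_graph 3 F \<and> digraph_iso G (line_graph F))
    \<or> (\<exists>v \<in> pverts G.
          out_degree (graph_square G) v \<le> 9
        \<and> (\<forall>x \<in> open_nbhd G v. out_degree (graph_square G) x \<le> 11)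
        \<and> ((\<exists>x \<in> open_nbhd G v. out_degree (graph_square G) x \<le> 10)
           \<or> induces_clique (graph_square (pre_digraph.del_vert G v)) (open_nbhd G v)))"
  using assms by (rule pair_graph.icosahedron_or_line_graph_or_ordinary_vertex)

end
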